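(* Let $G$ be a connected graph of order $n$ with vertices $g_1,\dots,g_n$ and maximum degree $\Delta(G)$. For $i=1,\dots,n$ let $H_i$ be a connected graph of order $m_i+1$ containing the star $S_{m_i}$ as a subgraph, and let $v_i$ be the center of this star, i.e. $v_i$ is adjacent in $H_i$ to all other $m_i$ vertices of $H_i$. Assume $m_1\ge m_2\ge\dots\ge m_n>\Delta(G)$. Let $G'=G\circ_{v_i}H_i$ be the graph obtained from the disjoint union of $G,H_1,\dots,H_n$ by adding the edges $g_iv_i$, $i=1,\dots,n$. Then Algorithm H2 applied to $G'$ (with any tie-breaking) returns a global dominating set of $G'$ of minimum cardinality.
   Context: All graphs are finite and simple; $V$ denotes the vertex set of the input graph. For a vertex $x$ and $A\subseteq V$: $N(x)$ is the set of neighbors of $x$, $N[x]=N(x)\cup\{x\}$, $N_A(x)=N(x)\cap A$, $N_A[x]=N_A(x)\cup\{x\}$, $\overline{N}(x)$ is the set of vertices other than $x$ not adjacent to $x$, $\overline{N}_A(x)=\overline{N}(x)\cap A$, $\overline{N}_A[x]=\overline{N}_A(x)\cup\{x\}$. For $D\subseteq V$: $N[D]=\bigcup_{x\in D}N[x]$ and $\overline{N}[D]=\bigcup_{x\in D}(\overline{N}(x)\cup\{x\})$ (both empty if $D=\emptyset$). A set $D$ is a dominating set of a graph if every vertex outside $D$ has a neighbor in $D$; $D$ (nonempty) is a global dominating set if it is a dominating set of both the graph and its complement $\overline{G}$ (equivalently, every vertex outside $D$ has both a neighbor and a non-neighbor in $D$). Algorithm H2: start with $D=\emptyset$. While $D$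 is not a global dominating set, perform an iteration: (1) if $D$ is not a dominating set of the graph, choose $v\in V\setminus D$ maximizing $|N_{V\setminus N[D]}[v]|$, and among such maximizers one maximizing $|\overline{N}_{V\setminus\overline{N}[D]}[v]|$ (remaining ties arbitrary), and add $v$ to $D$; (2) then, if $D$ is not a dominating set of the complement, choose $u\in V\setminus D$ maximizing $|\overline{N}_{V\setminus\overline{N}[D]}[u]|$, and among such maximizers one maximizing $|N_{V\setminus N[D]}[u]|$ (remaining ties arbitrary), and add $u$ to $D$. Output $D$ when it is a global dominating set. *)

theory Defs
  imports "Graph_Theory.Graph_Theory"
begin

text \<open>
  A finite simple graph is a finite, loop-free, symmetric digraph without parallel arcs
  (locale \<^locale>\<open>pair_graph\<close>); an undirected edge is a pair of opposite arcs.
\<close>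

definition nbrs :: "'a pair_pre_digraph \<Rightarrow> 'a \<Rightarrow> 'a set" where
  "nbrs G x = {y \<in> pverts G. (x, y) \<in> parcs G}"

definition closed_nbrs :: "'a pair_pre_digraph \<Rightarrow> 'a \<Rightarrow> 'a set" where
  "closed_nbrs G x = nbrs G x \<union> {x}"

definition non_nbrs :: "'a pair_pre_digraph \<Rightarrow> 'a \<Rightarrow> 'a set" where
  "non_nbrs G x = {y \<in> pverts G. y \<noteq> x \<and> (x, y) \<notin> parcs G}"

definition closed_non_nbrs :: "'a pair_pre_digraph \<Rightarrow> 'a \<Rightarrow> 'a set" where
  "closed_non_nbrs G x = non_nbrs G x \<union> {x}"

text \<open>
  Closed (non-)neighbourhoods relative to a set \<open>A\<close>. The vertex \<open>x\<close> belongs to them even if it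
  is not in \<open>A\<close>.
\<close>

definition closed_nbrs_in :: "'a pair_pre_digraph \<Rightarrow> 'a set \<Rightarrow> 'a \<Rightarrow> 'a set" where
  "closed_nbrs_in G A x = (nbrs G x \<inter> A) \<union> {x}"

definition closed_non_nbrs_in :: "'a pair_pre_digraph \<Rightarrow> 'a set \<Rightarrow> 'a \<Rightarrow> 'a set" where
  "closed_non_nbrs_in G A x = (non_nbrs G x \<inter> A) \<union> {x}"

definition max_degree :: "'a pair_pre_digraph \<Rightarrow> nat" where
  "max_degree G = Max ((\<lambda>x. card (nbrs G x)) ` pverts G)"

definition complement_graph :: "'a pair_pre_digraph \<Rightarrow> 'a pair_pre_digraph" where
  "complement_graph G =
    \<lparr> pverts = pverts G,
      parcs = {(x, y). x \<in> pverts G \<and> y \<in> pverts G \<and> x \<noteq> y \<and> (x, y) \<notin> parcs G} \<rparr>"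

definition dominating_set :: "'a pair_pre_digraph \<Rightarrow> 'a set \<Rightarrow> bool" where
  "dominating_set G D \<longleftrightarrow> D \<subseteq> pverts G \<and> (\<forall>x \<in> pverts G - D. nbrs G x \<inter> D \<noteq> {})"

definition global_dominating_set :: "'a pair_pre_digraph \<Rightarrow> 'a set \<Rightarrow> bool" where
  "global_dominating_set G D \<longleftrightarrow>
    D \<noteq> {} \<and> dominating_set G D \<and> dominating_set (complement_graph G) D"

definition minimum_global_dominating_set :: "'a pair_pre_digraph \<Rightarrow> 'a set \<Rightarrow> bool" where
  "minimum_global_dominating_set G D \<longleftrightarrow>
    global_dominating_set G D \<and> (\<forall>D'. global_dominating_set G D' \<longrightarrow> card D \<le> card D')"

text \<open>
  \<open>H2_gain G D x\<close> and \<open>H2_co_gain G D x\<close> are the numbers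
  $|N_{V \setminus N[D]}[x]|$ and $|\overline{N}_{V \setminus \overline{N}[D]}[x]|$.
\<close>

definition H2_gain :: "'a pair_pre_digraph \<Rightarrow> 'a set \<Rightarrow> 'a \<Rightarrow> nat" where
  "H2_gain G D x = card (closed_nbrs_in G (pverts G - (\<Union>y\<in>D. closed_nbrs G y)) x)"

definition H2_co_gain :: "'a pair_pre_digraph \<Rightarrow> 'a set \<Rightarrow> 'a \<Rightarrow> nat" where
  "H2_co_gain G D x = card (closed_non_nbrs_in G (pverts G - (\<Union>y\<in>D. closed_non_nbrs G y)) x)"

text \<open>
  The two steps of an iteration are relations between the set before and the set after the step.
  In both, the inner \<^const>\<open>is_arg_max\<close> is the first criterion and the outer one chooses
  among its maximizers; every choice that remains is allowed.
\<close>

definition H2_step1 :: "'a pair_pre_digraph \<Rightarrow> 'a set \<Rightarrow> 'a set \<Rightarrow> bool" where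
  "H2_step1 G D D' \<longleftrightarrow>
    (if dominating_set G D then D' = D
     else \<exists>v. is_arg_max (H2_co_gain G D) (is_arg_max (H2_gain G D) (\<lambda>x. x \<in> pverts G - D)) v
            \<and> D' = insert v D)"

definition H2_step2 :: "'a pair_pre_digraph \<Rightarrow> 'a set \<Rightarrow> 'a set \<Rightarrow> bool" where
  "H2_step2 G D D' \<longleftrightarrow>
    (if dominating_set (complement_graph G) D then D' = D
     else \<exists>u. is_arg_max (H2_gain G D) (is_arg_max (H2_co_gain G D) (\<lambda>x. x \<in> pverts G - D)) u
            \<and> D' = insert u D)"

definition H2_iteration :: "'a pair_pre_digraph \<Rightarrow> 'a set \<Rightarrow> 'a set \<Rightarrow> bool" where
  "H2_iteration G D D' \<longleftrightarrow>
    \<not> global_dominating_set G D \<and> (\<exists>D1. H2_step1 G D D1 \<and> H2_step2 G D1 D')"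

definition H2_output :: "'a pair_pre_digraph \<Rightarrow> 'a set \<Rightarrow> bool" where
  "H2_output G D \<longleftrightarrow> (H2_iteration G)\<^sup>*\<^sup>* {} D \<and> global_dominating_set G D"

text \<open>
  Whatever choices are made, a run does not go on forever, and it does not get stuck before it
  has reached a global dominating set.
\<close>

definition H2_terminates :: "'a pair_pre_digraph \<Rightarrow> bool" where
  "H2_terminates G \<longleftrightarrow>
    \<not> (\<exists>f :: nat \<Rightarrow> 'a set. f 0 = {} \<and> (\<forall>k. H2_iteration G (f k) (f (Suc k)))) \<and>
    (\<forall>D. (H2_iteration G)\<^sup>*\<^sup>* {} D \<longrightarrow> \<not> global_dominating_set G D \<longrightarrow>
         (\<exists>D'. H2_iteration G D D'))"

text \<open>
  The disjoint union of \<open>G\<close> and \<open>H 1, \<dots>, H n\<close>, with the edges between \<open>g i\<close> and \<open>v i\<close> added.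
  \<open>Inl x\<close> is the vertex \<open>x\<close> of \<open>G\<close>, and \<open>Inr (i, x)\<close> is the vertex \<open>x\<close> of \<open>H i\<close>.
\<close>

definition corona ::
  "'a pair_pre_digraph \<Rightarrow> nat \<Rightarrow> (nat \<Rightarrow> 'a) \<Rightarrow> (nat \<Rightarrow> 'b pair_pre_digraph) \<Rightarrow> (nat \<Rightarrow> 'b)
    \<Rightarrow> ('a + nat \<times> 'b) pair_pre_digraph" where
  "corona G n g H v =
    \<lparr> pverts = Inl ` pverts G \<union> Inr ` (SIGMA i:{1..n}. pverts (H i)),
      parcs = {(Inl x, Inl y) | x y. (x, y) \<in> parcs G}
        \<union> {(Inr (i, x), Inr (i, y)) | i x y. i \<in> {1..n} \<and> (x, y) \<in> parcs (H i)}
        \<union> {(Inl (g i), Inr (i, v i)) | i. i \<in> {1..n}}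
        \<union> {(Inr (i, v i), Inl (g i)) | i. i \<in> {1..n}} \<rparr>"

lemma ex_is_arg_max_is_arg_max:
  fixes f h :: "'a \<Rightarrow> nat"
  assumes "finite S" "S \<noteq> {}"
  shows "\<exists>x. is_arg_max h (is_arg_max f (\<lambda>x. x \<in> S)) x"
proof -
  have max_ex: "\<exists>x. is_arg_max k (\<lambda>x. x \<in> T) x" if "finite T" "T \<noteq> {}" for k :: "'a \<Rightarrow> nat" and T
  proof -
    have "Max (k ` T) \<in> k ` T" using that by simp
    then obtain x where "x \<in> T" "k x = Max (k ` T)" by auto
    then have "is_arg_max k (\<lambda>x. x \<in> T) x"
      using that by (auto simp: is_arg_max_linorder)
    then show ?thesis by blast
  qed
  let ?T = "{x. is_arg_max f (\<lambda>x. x \<in> S) x}"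
  have "?T \<subseteq> S" by (auto simp: is_arg_max_def)
  then have "finite ?T" "?T \<noteq> {}"
    using max_ex[OF assms, of f] assms(1) finite_subset by auto
  from max_ex[OF this, of h] show ?thesis by simp
qed

text \<open>Each of the two steps can always be carried out.\<close>

lemma H2_step_exists:
  assumes "finite (pverts G)" "D \<subseteq> pverts G"
  shows "\<exists>D'. H2_step1 G D D'" and "\<exists>D'. H2_step2 G D D'"
proof -
  have S: "finite (pverts G - D)" using assms(1) by simp
  have "pverts G - D \<noteq> {}" if "\<not> dominating_set G D"
    using that assms(2) by (auto simp: dominating_set_def)
  then show "\<exists>D'. H2_step1 G D D'"
    using ex_is_arg_max_is_arg_max[OF S, of "H2_co_gain G D" "H2_gain G D"]
    by (auto simp: H2_step1_def)
  have "pverts G - D \<noteq> {}" if "\<not> dominating_set (complement_graph G) D"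
    using that assms(2) by (auto simp: dominating_set_def complement_graph_def)
  then show "\<exists>D'. H2_step2 G D D'"
    using ex_is_arg_max_is_arg_max[OF S, of "H2_gain G D" "H2_co_gain G D"]
    by (auto simp: H2_step2_def)
qed

lemma pair_graph_complement_graph:
  assumes "pair_graph G"
  shows "pair_graph (complement_graph G)"
proof -
  interpret pair_graph G by fact
  have "finite (parcs (complement_graph G))"
    by (rule finite_subset[of _ "pverts G \<times> pverts G"])
      (auto simp: complement_graph_def pair_finite_verts)
  moreover have "symmetric (with_proj (complement_graph G))"
    using pair_sym_arcs by (auto simp: symmetric_def sym_def complement_graph_def)
  ultimately show ?thesis
    by unfold_locales (auto simp: complement_graph_def pair_finite_verts)
qed

lemma nbrs_complement_graph:
  "x \<in> pverts G \<Longrightarrow> nbrs (complement_graph G) x = non_nbrs G x"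
  by (auto simp: nbrs_def non_nbrs_def complement_graph_def)

lemma pair_graph_corona:
  assumes "pair_graph G" and H: "\<And>i. i \<in> {1..n} \<Longrightarrow> pair_graph (H i)"
    and g: "\<And>i. i \<in> {1..n} \<Longrightarrow> g i \<in> pverts G"
    and v: "\<And>i. i \<in> {1..n} \<Longrightarrow> v i \<in> pverts (H i)"
  shows "pair_graph (corona G n g H v)"
proof -
  let ?K = "corona G n g H v"
  interpret G: pair_graph G by fact
  have H_finite: "finite (pverts (H i))"
    and H_wf: "(x, y) \<in> parcs (H i) \<Longrightarrow> x \<in> pverts (H i) \<and> y \<in> pverts (H i)"
    and H_sym: "(x, y) \<in> parcs (H i) \<Longrightarrow> (y, x) \<in> parcs (H i)"
    and H_loopfree: "(x, x) \<notin> parcs (H i)" if "i \<in> {1..n}" for i x y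
  proof -
    interpret pair_graph "H i" using H that .
    show "finite (pverts (H i))" by (rule pair_finite_verts)
    show "(x, y) \<in> parcs (H i) \<Longrightarrow> x \<in> pverts (H i) \<and> y \<in> pverts (H i)"
      by (blast dest: in_arcsD1 in_arcsD2)
    show "(x, y) \<in> parcs (H i) \<Longrightarrow> (y, x) \<in> parcs (H i)"
      using pair_sym_arcs by (simp add: symmetric_def sym_def)
    show "(x, x) \<notin> parcs (H i)"
      using pair_no_loops[of "(x, x)"] by auto
  qed
  have G_sym: "(x, y) \<in> parcs G \<Longrightarrow> (y, x) \<in> parcs G" for x y
    using G.pair_sym_arcs by (simp add: symmetric_def sym_def)
  have G_loopfree: "(x, x) \<notin> parcs G" for x
    using G.pair_no_loops[of "(x, x)"] by auto
  have wf: "parcs ?K \<subseteq> pverts ?K \<times> pverts ?K"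
    unfolding corona_def using g v H_wf G.in_arcsD1 G.in_arcsD2 by (auto simp del: atLeastAtMost_iff One_nat_def)
  have fin: "finite (pverts ?K)"
    unfolding corona_def using H_finite G.pair_finite_verts by (simp del: atLeastAtMost_iff One_nat_def)
  then have fin_arcs: "finite (parcs ?K)"
    using wf finite_subset by blast
  have "sym (parcs ?K)"
    unfolding corona_def by (rule symI) (auto simp del: atLeastAtMost_iff One_nat_def dest: H_sym G_sym)
  then have symK: "symmetric (with_proj ?K)"
    by (simp add: symmetric_def)
  have loopfree: "(x, x) \<notin> parcs ?K" for x
    unfolding corona_def using H_loopfree G_loopfree by (auto simp del: atLeastAtMost_iff One_nat_def)
  show ?thesis
  proof unfold_locales
    show "fst e \<in> pverts ?K" "snd e \<in> pverts ?K" if "e \<in> parcs ?K" for e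
      using wf that by auto
    show "fst e \<noteq> snd e" if "e \<in> parcs ?K" for e
      using loopfree that by (metis prod.collapse)
  qed (use fin fin_arcs symK in simp_all)
qed

end

theory Submission
  imports Defs
begin

text \<open>
  Let \<open>c i\<close> be the centre \<open>v i\<close> of \<open>H i\<close>, seen in the corona. Every \<open>H i\<close> contains a vertex other than \<open>v i\<close>, all
  of whose neighbours lie in \<open>H i\<close>; so every dominating set of the corona meets every \<open>H i\<close> and
  has at least \<open>n\<close> elements. As long as the current set consists of centres, an unused centre \<open>c j\<close>
  has gain \<open>m j + 2\<close>, which beats every vertex of \<open>G\<close> (gain at most \<open>max_degree G + 2\<close>) and every
  other vertex of \<open>H j\<close> (gain at most \<open>m j + 1\<close>). Hence step 1 always adds a centre. Two centres
  have no common neighbour, so they dominate the complement, and step 2 is active only on a single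
  centre; there every other centre has the largest co-gain possible, and the second criterion
  again selects a centre. So if \<open>n \<ge> 2\<close>, the output is a set of centres and has at most \<open>n\<close>
  elements. If \<open>n = 1\<close>, the centre is adjacent to all other vertices, the minimum is 2, and one
  iteration reaches it.
\<close>

section \<open>Runs of Algorithm H2 on an arbitrary finite nonempty graph\<close>

lemma pverts_complement_graph [simp]: "pverts (complement_graph K) = pverts K"
  by (simp add: complement_graph_def)

text \<open>In a nonempty graph the empty set does not dominate, so the clause
  \<open>D \<noteq> {}\<close> of \<open>global_dominating_set\<close> adds no third case.\<close>

lemma not_global_dominating_set_cases:
  assumes "pverts K \<noteq> {}" "\<not> global_dominating_set K D"
  obtains "\<not> dominating_set K D" | "\<not> dominating_set (complement_graph K) D"
  using assms by (auto simp: global_dominating_set_def dominating_set_def)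

lemma H2_step1_subset:
  assumes "H2_step1 K D D'" "D \<subseteq> pverts K"
  shows "D \<subseteq> D'" "D' \<subseteq> pverts K" "\<not> dominating_set K D \<Longrightarrow> D \<noteq> D'"
  using assms by (auto simp: H2_step1_def is_arg_max_linorder split: if_splits)

lemma H2_step2_subset:
  assumes "H2_step2 K D D'" "D \<subseteq> pverts K"
  shows "D \<subseteq> D'" "D' \<subseteq> pverts K" "\<not> dominating_set (complement_graph K) D \<Longrightarrow> D \<noteq> D'"
  using assms by (auto simp: H2_step2_def is_arg_max_linorder split: if_splits)

text \<open>If step 1 leaves \<open>D\<close> unchanged, step 2 sees the same \<open>D\<close>;
  since one of the two domination conditions fails for it, at least one of the steps adds a
  vertex.\<close>

lemma H2_iteration_psubset:
  assumes "pverts K \<noteq> {}" "D \<subseteq> pverts K" "H2_iteration K D D'"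
  shows "D \<subset> D'" "D' \<subseteq> pverts K"
proof -
  obtain D1 where D1: "H2_step1 K D D1" "H2_step2 K D1 D'" and nogds: "\<not> global_dominating_set K D"
    using assms(3) by (auto simp: H2_iteration_def)
  note s1 = H2_step1_subset[OF D1(1) assms(2)]
  note s2 = H2_step2_subset[OF D1(2) s1(2)]
  show "D' \<subseteq> pverts K" by (rule s2)
  from assms(1) nogds have "D \<noteq> D1 \<or> D1 \<noteq> D'"
    by (cases rule: not_global_dominating_set_cases) (use s1(3) s2(3) in blast)+
  then show "D \<subset> D'" using s1(1) s2(1) by blast
qed

lemma H2_reachable_subset:
  assumes "pverts K \<noteq> {}" "(H2_iteration K)\<^sup>*\<^sup>* {} D"
  shows "D \<subseteq> pverts K"
  using assms(2) by induction (use H2_iteration_psubset[OF assms(1)] in auto)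

text \<open>Strict growth inside a finite vertex set bounds the number of iterations. A run cannot
  get stuck, because each step can be carried out on every set of vertices.\<close>

lemma H2_terminates_finite:
  assumes fin: "finite (pverts K)" and ne: "pverts K \<noteq> {}"
  shows "H2_terminates K"
  unfolding H2_terminates_def
proof (intro conjI allI impI notI)
  assume "\<exists>f :: nat \<Rightarrow> 'a set. f 0 = {} \<and> (\<forall>k. H2_iteration K (f k) (f (Suc k)))"
  then obtain f where f0: "f 0 = {}" and f: "\<And>k. H2_iteration K (f k) (f (Suc k))"
    by auto
  have sub: "f k \<subseteq> pverts K" for k
    by (induction k) (use f0 H2_iteration_psubset[OF ne _ f] in auto)
  have card_ge: "k \<le> card (f k)" for k
  proof (induction k)
    case (Suc k)
    have "card (f k) < card (f (Suc k))"
      using H2_iteration_psubset(1)[OF ne sub f] sub fin by (meson psubset_card_mono rev_finite_subset)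
    then show ?case using Suc by simp
  qed simp
  have "card (f (Suc (card (pverts K)))) \<le> card (pverts K)"
    by (rule card_mono[OF fin sub])
  then show False using card_ge[of "Suc (card (pverts K))"] by simp
next
  fix D assume D: "(H2_iteration K)\<^sup>*\<^sup>* {} D" "\<not> global_dominating_set K D"
  have sub: "D \<subseteq> pverts K" by (rule H2_reachable_subset[OF ne D(1)])
  obtain D1 where D1: "H2_step1 K D D1" using H2_step_exists(1)[OF fin sub] by blast
  moreover obtain D2 where "H2_step2 K D1 D2"
    using H2_step_exists(2)[OF fin H2_step1_subset(2)[OF D1 sub]] by blast
  ultimately show "\<exists>D'. H2_iteration K D D'" using D(2) unfolding H2_iteration_def by blast
qed

section \<open>Vertices, arcs and neighbourhoods of the corona\<close>

lemma corona_arcs [simp]: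
  "(Inl x, Inl y) \<in> parcs (corona G n g H v) \<longleftrightarrow> (x, y) \<in> parcs G"
  "(Inl x, Inr (i, b)) \<in> parcs (corona G n g H v) \<longleftrightarrow> i \<in> {1..n} \<and> x = g i \<and> b = v i"
  "(Inr (i, b), Inl x) \<in> parcs (corona G n g H v) \<longleftrightarrow> i \<in> {1..n} \<and> x = g i \<and> b = v i"
  "(Inr (i, a), Inr (j, b)) \<in> parcs (corona G n g H v) \<longleftrightarrow>
     i = j \<and> i \<in> {1..n} \<and> (a, b) \<in> parcs (H i)"
  by (auto simp: corona_def)

lemma corona_verts [simp]:
  "Inl x \<in> pverts (corona G n g H v) \<longleftrightarrow> x \<in> pverts G"
  "Inr (i, b) \<in> pverts (corona G n g H v) \<longleftrightarrow> i \<in> {1..n} \<and> b \<in> pverts (H i)"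
  by (auto simp: corona_def)

locale star_corona =
  fixes G :: "'a pair_pre_digraph" and n :: nat and g :: "nat \<Rightarrow> 'a"
    and H :: "nat \<Rightarrow> 'b pair_pre_digraph" and v :: "nat \<Rightarrow> 'b" and m :: "nat \<Rightarrow> nat"
  assumes G: "pair_graph G" and n_pos: "1 \<le> n"
    and g: "bij_betw g {1..n} (pverts G)"
    and H: "\<And>i. i \<in> {1..n} \<Longrightarrow> pair_graph (H i)"
    and card_H: "\<And>i. i \<in> {1..n} \<Longrightarrow> card (pverts (H i)) = m i + 1"
    and v: "\<And>i. i \<in> {1..n} \<Longrightarrow> v i \<in> pverts (H i)"
    and star: "\<And>i x. i \<in> {1..n} \<Longrightarrow> x \<in> pverts (H i) - {v i} \<Longrightarrow> (v i, x) \<in> parcs (H i)"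
    and m_gt: "\<And>i. i \<in> {1..n} \<Longrightarrow> max_degree G < m i"
begin

abbreviation K :: "('a + nat \<times> 'b) pair_pre_digraph" where
  "K \<equiv> corona G n g H v"

definition centre :: "nat \<Rightarrow> 'a + nat \<times> 'b" where
  "centre i = Inr (i, v i)"

definition branch :: "nat \<Rightarrow> ('a + nat \<times> 'b) set" where
  "branch i = (\<lambda>x. Inr (i, x)) ` pverts (H i)"

lemma g_vert: "i \<in> {1..n} \<Longrightarrow> g i \<in> pverts G"
  using g by (auto simp: bij_betw_def)

lemma g_surj: "x \<in> pverts G \<Longrightarrow> \<exists>i\<in>{1..n}. x = g i"
  using g by (force simp: bij_betw_def)

lemma g_eq_iff: "i \<in> {1..n} \<Longrightarrow> j \<in> {1..n} \<Longrightarrow> g i = g j \<longleftrightarrow> i = j"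
  using g by (auto simp: bij_betw_def inj_on_eq_iff)

lemma finite_H: "i \<in> {1..n} \<Longrightarrow> finite (pverts (H i))"
  \<comment> \<open>An infinite set has \<open>card\<close> equal to 0, whereas
    \<open>card_H\<close> gives a positive number.\<close>
  using card_H by (metis add_is_0 card.infinite one_neq_zero)

lemma finite_branch: "i \<in> {1..n} \<Longrightarrow> finite (branch i)"
  by (simp add: branch_def finite_H)

lemma card_branch: "i \<in> {1..n} \<Longrightarrow> card (branch i) = m i + 1"
  unfolding branch_def by (subst card_image) (auto simp: inj_on_def card_H)

lemma finite_G: "finite (pverts G)"
  using g bij_betw_finite by blast

lemma pair_graph_K: "pair_graph K"
  by (rule pair_graph_corona) (use G H g_vert v in blast)+

lemma K_sym: "(x, y) \<in> parcs K \<Longrightarrow> (y, x) \<in> parcs K"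
proof -
  interpret pair_graph K by (rule pair_graph_K)
  show "(x, y) \<in> parcs K \<Longrightarrow> (y, x) \<in> parcs K"
    using pair_sym_arcs by (simp add: symmetric_def sym_def)
qed

lemma K_loopfree: "(x, x) \<notin> parcs K"
proof -
  interpret pair_graph K by (rule pair_graph_K)
  show ?thesis using pair_no_loops[of "(x, x)"] by auto
qed

lemma finite_K: "finite (pverts K)"
proof -
  interpret pair_graph K by (rule pair_graph_K)
  show ?thesis by (rule pair_finite_verts)
qed

lemma finite_nbrs_K: "finite (nbrs K x)"
  by (rule finite_subset[OF _ finite_K]) (auto simp: nbrs_def)

lemma centre_vert: "i \<in> {1..n} \<Longrightarrow> centre i \<in> pverts K"
  using v by (simp add: centre_def)

lemma K_nonempty: "pverts K \<noteq> {}"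
  using centre_vert[of 1] n_pos by auto

lemma inj_centre: "inj centre"
  by (auto simp: inj_def centre_def)

lemma nbrs_centre:
  assumes i: "i \<in> {1..n}"
  shows "nbrs K (centre i) = insert (Inl (g i)) (branch i - {centre i})"
proof (rule set_eqI)
  fix y
  have loop: "(v i, v i) \<notin> parcs (H i)"
    using K_loopfree[of "centre i"] i by (simp add: centre_def)
  show "y \<in> nbrs K (centre i) \<longleftrightarrow> y \<in> insert (Inl (g i)) (branch i - {centre i})"
  proof (cases y)
    case (Inl a)
    then show ?thesis using i g_vert by (auto simp: nbrs_def centre_def branch_def)
  next
    case (Inr p)
    obtain j b where "p = (j, b)" by (cases p)
    then show ?thesis using Inr i star[OF i, of b] loop
      by (auto simp: nbrs_def centre_def branch_def)
  qed
qed

lemma closed_nbrs_centre: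
  "i \<in> {1..n} \<Longrightarrow> closed_nbrs K (centre i) = insert (Inl (g i)) (branch i)"
  using v by (auto simp: closed_nbrs_def nbrs_centre) (auto simp: branch_def centre_def)

text \<open>A leaf here is any vertex of \<open>H i\<close> other than \<open>v i\<close>, whatever
  its degree. The only edge leaving the copy of \<open>H i\<close> starts at the centre.\<close>

lemma nbrs_leaf:
  assumes "i \<in> {1..n}" "x \<noteq> v i"
  shows "nbrs K (Inr (i, x)) \<subseteq> branch i"
proof
  fix y assume "y \<in> nbrs K (Inr (i, x))"
  then show "y \<in> branch i"
    using assms by (cases y) (auto simp: nbrs_def branch_def)
qed

lemma card_nbrs_base:
  assumes "x \<in> pverts G"
  shows "card (nbrs K (Inl x)) \<le> max_degree G + 1"
proof -
  obtain i where i: "i \<in> {1..n}" "x = g i" using assms g_surj by blast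
  \<comment> \<open>Injectivity of \<open>g\<close> makes \<open>centre i\<close> the only neighbour
    of \<open>Inl x\<close> outside the copy of \<open>G\<close>.\<close>
  have sub: "nbrs K (Inl x) \<subseteq> insert (centre i) (Inl ` nbrs G x)"
  proof
    fix y assume "y \<in> nbrs K (Inl x)"
    then show "y \<in> insert (centre i) (Inl ` nbrs G x)"
      using i g_eq_iff by (cases y) (auto simp: nbrs_def centre_def)
  qed
  have fin: "finite (nbrs G x)"
    by (rule finite_subset[OF _ finite_G]) (auto simp: nbrs_def)
  have "card (nbrs K (Inl x)) \<le> card (insert (centre i) (Inl ` nbrs G x :: ('a + nat \<times> 'b) set))"
    by (rule card_mono[OF _ sub]) (simp add: fin)
  also have "\<dots> \<le> card (nbrs G x) + 1"
    by (simp add: card_insert_if fin card_image)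
  also have "card (nbrs G x) \<le> max_degree G"
    unfolding max_degree_def using assms finite_G by simp
  finally show ?thesis by simp
qed

section \<open>Gains while the current set consists of centres\<close>

lemma H2_gain_le: "H2_gain K D x \<le> card (nbrs K x) + 1"
proof -
  \<comment> \<open>The extra 1 in the bound is \<open>x\<close> itself, which is counted even when
    it is already dominated.\<close>
  have "H2_gain K D x \<le> card (insert x (nbrs K x))"
    unfolding H2_gain_def
    by (rule card_mono) (auto simp: closed_nbrs_in_def finite_nbrs_K)
  also have "\<dots> \<le> card (nbrs K x) + 1"
    by (simp add: card_insert_if finite_nbrs_K)
  finally show ?thesis .
qed

text \<open>Closed neighbourhoods of distinct centres are disjoint. So nothing in that of
  \<open>centre j\<close> is covered yet: neither the \<open>m j + 1\<close> vertices of the branch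
  nor \<open>g j\<close>.\<close>

lemma H2_gain_centre:
  assumes I: "I \<subseteq> {1..n}" and j: "j \<in> {1..n}" "j \<notin> I"
  shows "m j + 2 \<le> H2_gain K (centre ` I) (centre j)"
proof -
  let ?A = "insert (Inl (g j)) (branch j)"
  have "card ?A = m j + 2"
    using finite_branch[OF j(1)] card_branch[OF j(1)]
    by (subst card_insert_disjoint) (auto simp: branch_def)
  moreover have "?A \<subseteq> closed_nbrs_in K (pverts K - (\<Union>y\<in>centre ` I. closed_nbrs K y)) (centre j)"
  proof
    fix y assume y: "y \<in> ?A"
    have "y \<notin> closed_nbrs K (centre i)" if "i \<in> I" for i
    proof -
      have "i \<in> {1..n}" "i \<noteq> j" using that I j by auto
      then show ?thesis using y j g_eq_iff[of i j]
        by (auto simp: closed_nbrs_centre branch_def simp del: atLeastAtMost_iff)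
    qed
    moreover have "y \<in> closed_nbrs K (centre j)" using y j by (simp add: closed_nbrs_centre)
    moreover have "y \<in> pverts K" using y j g_vert by (auto simp: branch_def)
    ultimately show "y \<in> closed_nbrs_in K (pverts K - (\<Union>y\<in>centre ` I. closed_nbrs K y)) (centre j)"
      by (auto simp: closed_nbrs_in_def closed_nbrs_def)
  qed
  ultimately show ?thesis
    unfolding H2_gain_def
    by (metis card_mono closed_nbrs_in_def finite_Int finite_Un finite_nbrs_K finite.emptyI
        finite_insert)
qed

lemma noncentre_gain_less:
  assumes I: "I \<subset> {1..n}" and x: "x \<in> pverts K" "x \<notin> range centre"
  shows "\<exists>j\<in>{1..n} - I. H2_gain K (centre ` I) x < H2_gain K (centre ` I) (centre j)"
proof -
  have gain: "m j + 2 \<le> H2_gain K (centre ` I) (centre j)" if "j \<in> {1..n} - I" for j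
    using H2_gain_centre[of I j] I that by blast
  obtain j where j: "j \<in> {1..n} - I" using I by blast
  show ?thesis
  proof (cases x)
    case (Inl a)
    then have "H2_gain K (centre ` I) x \<le> max_degree G + 2"
      using H2_gain_le[of "centre ` I" x] card_nbrs_base[of a] x by simp
    also have "\<dots> < m j + 2" using m_gt[of j] j by simp
    finally show ?thesis using gain[OF j] j by force
  next
    case (Inr p)
    then obtain k b where xk: "x = Inr (k, b)" by (cases p) auto
    then have k: "k \<in> {1..n}" "b \<in> pverts (H k)" "b \<noteq> v k"
      using x by (auto simp: centre_def)
    have nb: "nbrs K x \<subseteq> branch k" using nbrs_leaf k xk by simp
    show ?thesis
    proof (cases "k \<in> I")
      case True
      \<comment> \<open>\<open>centre k\<close> has covered the whole branch, so \<open>x\<close>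
        counts only itself.\<close>
      have "branch k \<subseteq> closed_nbrs K (centre k)" using closed_nbrs_centre[OF k(1)] by blast
      then have "closed_nbrs_in K (pverts K - (\<Union>y\<in>centre ` I. closed_nbrs K y)) x = {x}"
        using nb True by (auto simp: closed_nbrs_in_def)
      then have "H2_gain K (centre ` I) x = 1" by (simp add: H2_gain_def)
      then show ?thesis using gain[OF j] j by force
    next
      case False
      \<comment> \<open>Unlike \<open>centre k\<close>, the vertex \<open>x\<close> does not reach
        \<open>g k\<close>; this one vertex makes the inequality strict.\<close>
      have "closed_nbrs_in K (pverts K - (\<Union>y\<in>centre ` I. closed_nbrs K y)) x \<subseteq> branch k"
        using nb k xk by (auto simp: closed_nbrs_in_def branch_def)
      then have "H2_gain K (centre ` I) x \<le> m k + 1"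
        using card_mono[OF finite_branch[OF k(1)]] card_branch[OF k(1)] by (metis H2_gain_def)
      then show ?thesis using gain[of k] k False by force
    qed
  qed
qed

section \<open>Domination by centres and the lower bound for dominating sets\<close>

lemma dominating_set_centres: "dominating_set K (centre ` {1..n})"
  unfolding dominating_set_def
proof (intro conjI ballI)
  show "centre ` {1..n} \<subseteq> pverts K" using centre_vert by blast
  fix x assume x: "x \<in> pverts K - centre ` {1..n}"
  have "\<exists>i\<in>{1..n}. x \<in> nbrs K (centre i)"
  proof (cases x)
    case (Inl a)
    then obtain i where "i \<in> {1..n}" "a = g i" using x g_surj[of a] by auto
    then show ?thesis using Inl by (auto simp: nbrs_centre)
  next
    case (Inr p)
    then show ?thesis using x by (cases p) (force simp: nbrs_centre branch_def)
  qed
  then obtain i where "i \<in> {1..n}" "x \<in> nbrs K (centre i)" by blast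
  then have "centre i \<in> nbrs K x" using K_sym centre_vert by (auto simp: nbrs_def)
  then show "nbrs K x \<inter> centre ` {1..n} \<noteq> {}" using \<open>i \<in> {1..n}\<close> by blast
qed

lemma co_dominating_set_centres:
  assumes "I \<subseteq> {1..n}" "i \<in> I" "j \<in> I" "i \<noteq> j"
  shows "dominating_set (complement_graph K) (centre ` I)"
  unfolding dominating_set_def
proof (intro conjI ballI)
  show "centre ` I \<subseteq> pverts (complement_graph K)"
    using centre_vert assms(1) by auto
  fix x assume "x \<in> pverts (complement_graph K) - centre ` I"
  then have x: "x \<in> pverts K" "x \<notin> centre ` I" by simp_all
  have ij: "i \<in> {1..n}" "j \<in> {1..n}" using assms by blast+
  have "nbrs K (centre i) \<inter> nbrs K (centre j) = {}"
    using assms(4) g_eq_iff[OF ij]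
    by (auto simp: nbrs_centre[OF ij(1)] nbrs_centre[OF ij(2)] branch_def)
  then obtain k where k: "k \<in> I" "x \<notin> nbrs K (centre k)" using assms(2,3) by blast
  then have "centre k \<in> nbrs (complement_graph K) x"
    using x centre_vert assms(1) K_sym[of x "centre k"]
    by (auto simp: nbrs_complement_graph non_nbrs_def nbrs_def[of K])
  then show "nbrs (complement_graph K) x \<inter> centre ` I \<noteq> {}" using k by blast
qed

lemma leaf_exists:
  assumes "i \<in> {1..n}"
  obtains x where "x \<in> pverts (H i)" "x \<noteq> v i"
proof -
  \<comment> \<open>A single vertex would mean \<open>m i = 0\<close>, but \<open>m i\<close>
    exceeds a natural number.\<close>
  have "pverts (H i) \<noteq> {v i}" using card_H[OF assms] m_gt[OF assms] by auto
  then show ?thesis using that v[OF assms] by blast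
qed

lemma card_dominating_set_ge:
  assumes D: "dominating_set K D"
  shows "n \<le> card D"
proof -
  have "\<exists>d. d \<in> D \<inter> branch i" if i: "i \<in> {1..n}" for i
  proof -
    obtain x where x: "x \<in> pverts (H i)" "x \<noteq> v i" using leaf_exists[OF i] .
    show ?thesis
    proof (cases "Inr (i, x) \<in> D")
      case True
      then show ?thesis using x by (auto simp: branch_def)
    next
      case False
      then have "nbrs K (Inr (i, x)) \<inter> D \<noteq> {}" using D i x by (auto simp: dominating_set_def)
      then show ?thesis using nbrs_leaf[OF i x(2)] by blast
    qed
  qed
  \<comment> \<open>One element of \<open>D\<close> is chosen in each branch; the branches are
    pairwise disjoint, so the choice is injective.\<close>
  then obtain f where f: "\<And>i. i \<in> {1..n} \<Longrightarrow> f i \<in> D \<inter> branch i" by metis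
  have "inj_on f {1..n}"
  proof (rule inj_onI)
    fix i j assume ij: "i \<in> {1..n}" "j \<in> {1..n}" "f i = f j"
    show "i = j" using f[OF ij(1)] f[OF ij(2)] ij(3) by (auto simp: branch_def)
  qed
  moreover have "finite D" using D finite_K finite_subset by (auto simp: dominating_set_def)
  moreover have "f ` {1..n} \<subseteq> D" using f by blast
  ultimately show ?thesis using card_inj_on_le[of f "{1..n}" D] by simp
qed

section \<open>Both steps of an iteration add only centres\<close>

lemma H2_step1_centres:
  assumes I: "I \<subseteq> {1..n}" and step: "H2_step1 K (centre ` I) D'"
  obtains J where "J \<subseteq> {1..n}" "J \<noteq> {}" "D' = centre ` J"
proof (cases "dominating_set K (centre ` I)")
  case True
  \<comment> \<open>The empty set does not dominate a nonempty graph. Nonemptiness is recorded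
    because \<open>H2_step2_centres\<close> starts from it.\<close>
  then have "I \<noteq> {}" using K_nonempty by (auto simp: dominating_set_def)
  then show ?thesis using True step that[OF I] by (simp add: H2_step1_def)
next
  case False
  then have I': "I \<subset> {1..n}" using dominating_set_centres I by blast
  obtain u where u: "is_arg_max (H2_gain K (centre ` I)) (\<lambda>x. x \<in> pverts K - centre ` I) u"
    and D': "D' = insert u (centre ` I)"
    using step False by (auto simp: H2_step1_def is_arg_max_def)
  have uK: "u \<in> pverts K"
    and u_max: "\<And>y. y \<in> pverts K - centre ` I \<Longrightarrow> H2_gain K (centre ` I) y \<le> H2_gain K (centre ` I) u"
    using u by (auto simp: is_arg_max_linorder)
  have "u \<in> range centre"
  proof (rule ccontr)
    assume "u \<notin> range centre"
    then obtain j where j: "j \<in> {1..n} - I" "H2_gain K (centre ` I) u < H2_gain K (centre ` I) (centre j)"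
      using noncentre_gain_less[OF I' uK] by blast
    have "centre j \<in> pverts K - centre ` I"
      using j centre_vert inj_centre by (auto simp: inj_image_mem_iff)
    then show False using u_max j(2) by force
  qed
  then obtain j where j: "u = centre j" by blast
  then have "j \<in> {1..n}" using uK by (simp add: centre_def)
  then show ?thesis using that[of "insert j I"] I D' j by simp
qed

text \<open>Removing the closed non-neighbourhood of a centre leaves only neighbours of that centre;
  the extra 1 is again \<open>x\<close> itself.\<close>

lemma H2_co_gain_le: "H2_co_gain K {centre i} x \<le> card (nbrs K (centre i)) + 1"
proof -
  have "H2_co_gain K {centre i} x \<le> card (insert x (nbrs K (centre i)))"
    unfolding H2_co_gain_def
    by (rule card_mono)
      (auto simp: closed_non_nbrs_in_def closed_non_nbrs_def non_nbrs_def nbrs_def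
        intro: finite_subset[OF _ finite_K])
  also have "\<dots> \<le> card (nbrs K (centre i)) + 1"
    by (simp add: card_insert_if finite_nbrs_K)
  finally show ?thesis .
qed

text \<open>The bound of \<open>H2_co_gain_le\<close> is attained, because \<open>centre j\<close>
  is neither equal nor adjacent to any neighbour of \<open>centre i\<close>.\<close>

lemma H2_co_gain_centre:
  assumes ij: "i \<in> {1..n}" "j \<in> {1..n}" "i \<noteq> j"
  shows "H2_co_gain K {centre i} (centre j) = card (nbrs K (centre i)) + 1"
proof -
  have disj: "nbrs K (centre i) \<inter> closed_nbrs K (centre j) = {}"
    using ij g_eq_iff[OF ij(1,2)]
    by (auto simp: nbrs_centre[OF ij(1)] closed_nbrs_centre[OF ij(2)] branch_def)
  have "closed_non_nbrs_in K (pverts K - (\<Union>y\<in>{centre i}. closed_non_nbrs K y)) (centre j)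
      = insert (centre j) (nbrs K (centre i))"
    using disj K_loopfree
    by (auto simp: closed_non_nbrs_in_def closed_non_nbrs_def non_nbrs_def nbrs_def closed_nbrs_def)
  moreover have "centre j \<notin> nbrs K (centre i)"
    using disj by (auto simp: closed_nbrs_def)
  ultimately show ?thesis by (simp add: H2_co_gain_def finite_nbrs_K)
qed

lemma H2_step2_centres:
  assumes n: "2 \<le> n" and I: "I \<subseteq> {1..n}" "I \<noteq> {}" and step: "H2_step2 K (centre ` I) D'"
  obtains J where "J \<subseteq> {1..n}" "D' = centre ` J"
proof (cases "dominating_set (complement_graph K) (centre ` I)")
  case True
  then show ?thesis using step that[OF I(1)] by (simp add: H2_step2_def)
next
  case False
  obtain i where "i \<in> I" using I by blast
  then have Ii: "I = {i}" using co_dominating_set_centres[OF I(1)] False by blast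
  then have i: "i \<in> {1..n}" using I by blast
  let ?P = "\<lambda>x. x \<in> pverts K - centre ` I"
  obtain u where u: "is_arg_max (H2_gain K (centre ` I)) (is_arg_max (H2_co_gain K (centre ` I)) ?P) u"
    and D': "D' = insert u (centre ` I)"
    using step False by (auto simp: H2_step2_def)
  have uK: "u \<in> pverts K" using u by (auto simp: is_arg_max_linorder)
  have "card I \<noteq> card {1..n}" using n Ii by simp
  then have I': "I \<subset> {1..n}" using I by blast
  have "u \<in> range centre"
  proof (rule ccontr)
    assume "u \<notin> range centre"
    then obtain j where j: "j \<in> {1..n} - I" "H2_gain K (centre ` I) u < H2_gain K (centre ` I) (centre j)"
      using noncentre_gain_less[OF I' uK] by blast
    have "?P (centre j)"
      using j centre_vert inj_centre by (auto simp: inj_image_mem_iff)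
    moreover have "H2_co_gain K (centre ` I) y \<le> H2_co_gain K (centre ` I) (centre j)" for y
      using H2_co_gain_le[of i y] H2_co_gain_centre[OF i, of j] j(1) Ii by auto
    ultimately have "is_arg_max (H2_co_gain K (centre ` I)) ?P (centre j)"
      by (simp add: is_arg_max_linorder)
    then have "H2_gain K (centre ` I) (centre j) \<le> H2_gain K (centre ` I) u"
      using u unfolding is_arg_max_linorder[of "H2_gain K (centre ` I)"] by blast
    then show False using j(2) by simp
  qed
  then obtain j where j: "u = centre j" by blast
  then have "j \<in> {1..n}" using uK by (simp add: centre_def)
  then show ?thesis using that[of "insert j I"] I D' j by simp
qed

section \<open>Minimality of the output\<close>

lemma minimum_two_or_more:
  assumes n: "2 \<le> n" and D: "H2_output K D"
  shows "minimum_global_dominating_set K D"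
proof -
  have "(H2_iteration K)\<^sup>*\<^sup>* {} D" and gds: "global_dominating_set K D"
    using D by (auto simp: H2_output_def)
  from this(1) have "\<exists>I. I \<subseteq> {1..n} \<and> D = centre ` I"
  proof induction
    case (step D D')
    then obtain I D1 where I: "I \<subseteq> {1..n}" "D = centre ` I"
      and s: "H2_step1 K D D1" "H2_step2 K D1 D'"
      by (auto simp: H2_iteration_def)
    obtain J where J: "J \<subseteq> {1..n}" "J \<noteq> {}" "D1 = centre ` J"
      using H2_step1_centres[OF I(1)] s(1) I(2) by metis
    obtain J' where "J' \<subseteq> {1..n}" "D' = centre ` J'"
      using H2_step2_centres[OF n J(1,2)] s(2) J(3) by metis
    then show ?case by blast
  qed simp
  then obtain I where I: "I \<subseteq> {1..n}" "D = centre ` I" by blast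
  have "card D \<le> n"
    using I card_image_le[of I centre] card_mono[of "{1..n}" I] finite_subset[of I "{1..n}"] by simp
  then show ?thesis
    using gds card_dominating_set_ge le_trans
    by (force simp: minimum_global_dominating_set_def global_dominating_set_def)
qed

lemma minimum_one:
  assumes n: "n = 1" and D: "H2_output K D"
  shows "minimum_global_dominating_set K D"
proof -
  let ?c = "centre 1" and ?g = "Inl (g 1) :: 'a + nat \<times> 'b"
  have cK: "?c \<in> pverts K" using centre_vert n by simp
  have gK: "?g \<in> pverts K" using g_vert n by simp
  have verts: "pverts K = insert ?g (branch 1)"
    using g n by (auto simp: corona_def branch_def bij_betw_def)
  have nbc: "nbrs K ?c = pverts K - {?c}"
    using nbrs_centre[of 1] n verts by (auto simp: centre_def)
  have domc: "dominating_set K E" if "?c \<in> E" "E \<subseteq> pverts K" for E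
    unfolding dominating_set_def
  proof (intro conjI ballI)
    fix x assume "x \<in> pverts K - E"
    then have "x \<in> nbrs K ?c" using that nbc by blast
    then have "?c \<in> nbrs K x" using K_sym cK by (auto simp: nbrs_def)
    then show "nbrs K x \<inter> E \<noteq> {}" using that by blast
  qed (rule that)
  have g_not: "?g \<noteq> ?c" by (simp add: centre_def)
  \<comment> \<open>The centre has no non-neighbour, so it must lie in \<open>E\<close> itself. It
    cannot be alone there, since it is adjacent to \<open>?g\<close>.\<close>
  have ge2: "2 \<le> card E" if E: "global_dominating_set K E" for E
  proof -
    have E': "E \<subseteq> pverts K" using E by (auto simp: global_dominating_set_def dominating_set_def)
    have co: "non_nbrs K x \<inter> E \<noteq> {}" if "x \<in> pverts K - E" for x
      using E that by (auto simp: global_dominating_set_def dominating_set_def nbrs_complement_graph)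
    have "non_nbrs K ?c = {}" using nbc by (auto simp: nbrs_def non_nbrs_def)
    then have c: "?c \<in> E" using co[of ?c] cK by blast
    have "E \<noteq> {?c}"
    proof
      assume E1: "E = {?c}"
      have "?c \<notin> non_nbrs K ?g" using n by (simp add: non_nbrs_def centre_def)
      then show False using co[of ?g] E1 gK g_not by auto
    qed
    then have "card {?c} < card E"
      using c E' finite_K by (intro psubset_card_mono) (auto intro: finite_subset)
    then show ?thesis by simp
  qed
  have first: "global_dominating_set K D' \<and> card D' \<le> 2" if it: "H2_iteration K {} D'" for D'
  proof -
    obtain D1 where s: "H2_step1 K {} D1" "H2_step2 K D1 D'"
      using it by (auto simp: H2_iteration_def)
    obtain J where J: "J \<subseteq> {1..n}" "J \<noteq> {}" "D1 = centre ` J"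
      using H2_step1_centres[of "{}" D1] s(1) by auto
    then have "J = {1}" using n by auto
    then have D1: "D1 = {?c}" using J by simp
    have "\<not> dominating_set (complement_graph K) {?c}"
    proof
      assume "dominating_set (complement_graph K) {?c}"
      then have "global_dominating_set K {?c}"
        using domc[of "{?c}"] cK by (auto simp: global_dominating_set_def)
      then show False using ge2 by fastforce
    qed
    then obtain u where
      u: "is_arg_max (H2_co_gain K {?c}) (\<lambda>x. x \<in> pverts K - {?c}) u" and D': "D' = {u, ?c}"
      using s(2) D1 by (auto simp: H2_step2_def is_arg_max_def)
    have uK: "u \<in> pverts K - {?c}" and u_max: "H2_co_gain K {?c} ?g \<le> H2_co_gain K {?c} u"
      using u gK g_not by (auto simp: is_arg_max_linorder)
    let ?A = "pverts K - {?c}"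
    have un: "pverts K - (\<Union>y\<in>{?c}. closed_non_nbrs K y) = ?A"
      using nbc by (auto simp: closed_non_nbrs_def non_nbrs_def nbrs_def)
    \<comment> \<open>The only neighbour of \<open>?g\<close> is \<open>?c\<close>, so
      \<open>?g\<close> attains the largest possible co-gain \<open>card ?A\<close>. Any maximizer
      \<open>u\<close> must then also be nonadjacent to every vertex except \<open>?c\<close>, which
      makes \<open>{u, ?c}\<close> dominate the complement.\<close>
    have "closed_non_nbrs_in K ?A ?g = ?A"
      using gK g_not verts n
      by (auto simp: closed_non_nbrs_in_def non_nbrs_def centre_def branch_def)
    then have "card ?A \<le> card (closed_non_nbrs_in K ?A u)"
      using u_max unfolding H2_co_gain_def un by simp
    moreover have "closed_non_nbrs_in K ?A u \<subseteq> ?A"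
      using uK by (auto simp: closed_non_nbrs_in_def)
    ultimately have eq: "closed_non_nbrs_in K ?A u = ?A"
      using finite_K by (meson card_seteq finite_Diff)
    have "u \<in> non_nbrs K x" if "x \<in> pverts K - {u, ?c}" for x
    proof -
      have "x \<in> non_nbrs K u" using eq that by (auto simp: closed_non_nbrs_in_def)
      then show ?thesis using uK K_sym by (auto simp: non_nbrs_def)
    qed
    then have "dominating_set (complement_graph K) D'"
      using D' uK cK by (auto simp: dominating_set_def nbrs_complement_graph)
    then show ?thesis
      using domc[of D'] D' uK cK by (auto simp: global_dominating_set_def card_insert_if)
  qed
  have "(H2_iteration K)\<^sup>*\<^sup>* {} D" and gds: "global_dominating_set K D"
    using D by (auto simp: H2_output_def)
  \<comment> \<open>No iteration starts from a global dominating set, so the first iteration is also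
    the last.\<close>
  from this(1) have "D = {} \<or> global_dominating_set K D \<and> card D \<le> 2"
    by induction (use first in \<open>auto simp: H2_iteration_def\<close>)
  then have "card D \<le> 2" by auto
  then have "card D \<le> card E" if "global_dominating_set K E" for E
    using ge2[OF that] by linarith
  then show ?thesis using gds by (simp add: minimum_global_dominating_set_def)
qed

end

theorem theorem9:
  fixes G :: "'a pair_pre_digraph"
    and n :: nat
    and g :: "nat \<Rightarrow> 'a"
    and H :: "nat \<Rightarrow> 'b pair_pre_digraph"
    and v :: "nat \<Rightarrow> 'b"
    and m :: "nat \<Rightarrow> nat"
  assumes "pair_graph G" and "connected (with_proj G)"
    and "card (pverts G) = n" and "bij_betw g {1..n} (pverts G)"
    and "\<And>i. i \<in> {1..n} \<Longrightarrow> pair_graph (H i)"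
    and "\<And>i. i \<in> {1..n} \<Longrightarrow> connected (with_proj (H i))"
    and "\<And>i. i \<in> {1..n} \<Longrightarrow> card (pverts (H i)) = m i + 1"
    and "\<And>i. i \<in> {1..n} \<Longrightarrow> v i \<in> pverts (H i)"
    and "\<And>i x. i \<in> {1..n} \<Longrightarrow> x \<in> pverts (H i) - {v i} \<Longrightarrow> (v i, x) \<in> parcs (H i)"
    and "\<And>i j. i \<in> {1..n} \<Longrightarrow> j \<in> {1..n} \<Longrightarrow> i \<le> j \<Longrightarrow> m j \<le> m i"
    and "m n > max_degree G"
  shows "H2_terminates (corona G n g H v) \<and>
         (\<forall>D. H2_output (corona G n g H v) D \<longrightarrow>
              minimum_global_dominating_set (corona G n g H v) D)"
proof -
  \<comment> \<open>Connectedness includes having a vertex, which excludes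
    \<open>n = 0\<close>.\<close>
  have "pverts G \<noteq> {}" using assms(2) by (auto simp: connected_def strongly_connected_def)
  moreover have "finite (pverts G)" using assms(4) bij_betw_finite by blast
  ultimately have n: "1 \<le> n" using assms(3) by (metis One_nat_def Suc_leI card_gt_0_iff)
  have "max_degree G < m i" if "i \<in> {1..n}" for i
    using assms(10)[of i n] assms(11) that by auto
  then interpret star_corona G n g H v m
    by (intro star_corona.intro n assms)
  have "minimum_global_dominating_set K D" if "H2_output K D" for D
    using minimum_one minimum_two_or_more n that by (cases "n = 1") auto
  then show ?thesis using H2_terminates_finite[OF finite_K K_nonempty] by blast
qed

end
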